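(* Every $\Delta$-generated space is homeomorphic to the disjoint union of its non-empty connected components, which are also its non-empty path-connected components. In particular, a $\Delta$-generated space is connected if and only if it is path-connected.
   Context: A topological space $X$ is $\Delta$-generated if it carries the final topology with respect to all continuous maps $\Delta^n\to X$, $n\ge0$, where $\Delta^n$ is the standard topological $n$-simplex (equivalently, $X$ is the colimit of the diagram of all simplices mapping continuously to $X$). No separation condition is assumed. The disjoint union is taken in the category of topological spaces. *)

theory Defs
  imports "HOL-Homology.Simplices"
begin

abbreviation simplex_topology :: "nat \<Rightarrow> (nat \<Rightarrow> real) topology" where
  "simplex_topology n \<equiv> subtopology (powertop_real UNIV) (standard_simplex n)"

text \<open>
  The maps are total HOL functions, whose values outside the simplex are irrelevant; this is
  why the preimage is intersected with the simplex.
\<close>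

definition Delta_generated_space :: "'a topology \<Rightarrow> bool" where
  "Delta_generated_space X \<longleftrightarrow>
     (\<forall>U. openin X U \<longleftrightarrow>
        U \<subseteq> topspace X \<and>
        (\<forall>n f. continuous_map (simplex_topology n) X f \<longrightarrow>
           openin (simplex_topology n) {t \<in> standard_simplex n. f t \<in> U}))"

end

theory Submission
  imports Defs "HOL-Analysis.Abstract_Topological_Spaces"
begin

text \<open>
  A simplex is path-connected, so its image under a continuous map lies inside a single
  path component. Hence the preimage of a path component in any simplex is empty or everything,
  and the path components of a \<open>\<Delta>\<close>-generated space are open.  A partition into open connected
  sets is the partition into connected components and exhibits the space as their disjoint union.
\<close>

text \<open>The projection \<open>snd\<close>, which forgets the index of a summand, is the
  homeomorphism: the cover makes it surjective and disjointness makes it injective.\<close>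

lemma homeomorphic_space_sum_topology_partition:
  assumes disj: "pairwise disjnt \<C>"
    and cover: "\<Union>\<C> = topspace X"
    and op: "\<And>C. C \<in> \<C> \<Longrightarrow> openin X C"
  shows "X homeomorphic_space sum_topology (subtopology X) \<C>"
proof -
  have snd_Sigma: "snd ` Sigma \<C> T = \<Union>(T ` \<C>)" for T :: "'a set \<Rightarrow> 'a set"
    by force
  have "homeomorphic_map (sum_topology (subtopology X) \<C>) X snd"
  proof (rule bijective_open_imp_homeomorphic_map)
    show "continuous_map (sum_topology (subtopology X) \<C>) X snd"
      unfolding continuous_map_def
    proof (intro conjI allI impI)
      show "snd \<in> topspace (sum_topology (subtopology X) \<C>) \<rightarrow> topspace X"
        by auto
    next
      fix U
      assume U: "openin X U"
      have "{p \<in> topspace (sum_topology (subtopology X) \<C>). snd p \<in> U} = Sigma \<C> (\<lambda>C. U \<inter> C)"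
        using openin_subset [OF U] by auto
      then show "openin (sum_topology (subtopology X) \<C>)
          {p \<in> topspace (sum_topology (subtopology X) \<C>). snd p \<in> U}"
        using U by (simp add: openin_disjoint_union openin_subtopology_Int)
    qed
  next
    show "open_map (sum_topology (subtopology X) \<C>) X snd"
      unfolding open_map_def
    proof (intro allI impI)
      fix W
      assume "openin (sum_topology (subtopology X) \<C>) W"
      then obtain T where W: "W = Sigma \<C> T"
        and T: "\<And>C. C \<in> \<C> \<Longrightarrow> openin (subtopology X C) (T C)"
        by (auto simp: openin_sum_topology_alt)
      \<comment> \<open>Here the openness of the pieces enters: a relatively open subset of an open
        piece is open in \<open>X\<close>.\<close>
      have "openin X (T C)" if "C \<in> \<C>" for C
        using T op openin_open_subtopology that by blast
      then show "openin X (snd ` W)"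
        by (auto simp: W snd_Sigma)
    qed
  next
    show "snd ` topspace (sum_topology (subtopology X) \<C>) = topspace X"
    proof -
      have "(\<Union>C\<in>\<C>. topspace X \<inter> C) = topspace X"
        using cover by blast
      then show ?thesis
        by (simp add: snd_Sigma comp_def)
    qed
  next
    show "inj_on snd (topspace (sum_topology (subtopology X) \<C>))"
    proof (rule inj_onI)
      fix p q
      assume "p \<in> topspace (sum_topology (subtopology X) \<C>)"
        and "q \<in> topspace (sum_topology (subtopology X) \<C>)" and eq: "snd p = snd q"
      \<comment> \<open>A point of the sum lies in the piece that is its own index, so the common
        value of \<open>snd\<close> lies in both indices, and disjointness identifies them.\<close>
      then have "fst p \<in> \<C>" "fst q \<in> \<C>" "snd p \<in> fst p" "snd p \<in> fst q"
        by auto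
      then have "fst p = fst q"
        using disj by (meson disjnt_iff pairwiseD)
      with eq show "p = q"
        by (rule prod_eqI [rotated])
    qed
  qed
  then show ?thesis
    using homeomorphic_map_imp_homeomorphic_space homeomorphic_space_sym by blast
qed

lemma Delta_generated_space_openin_path_component:
  assumes X: "Delta_generated_space X" and C: "C \<in> path_components_of X"
  shows "openin X C"
proof -
  have "openin (simplex_topology n) {t \<in> standard_simplex n. f t \<in> C}"
    if f: "continuous_map (simplex_topology n) X f" for n f
  proof -
    have "path_connectedin X (f ` standard_simplex n)"
      using f path_connectedin_continuous_map_image path_connectedin_standard_simplex
        path_connectedin_subtopology by blast
    \<comment> \<open>A path component absorbs every path-connected set that it meets.\<close>
    then have "f ` standard_simplex n \<subseteq> C \<or> disjnt C (f ` standard_simplex n)"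
      using C path_components_of_maximal by blast
    then consider "{t \<in> standard_simplex n. f t \<in> C} = standard_simplex n"
      | "{t \<in> standard_simplex n. f t \<in> C} = {}"
      by (auto simp: disjnt_iff)
    then show ?thesis
    proof cases
      case 1
      then show ?thesis
        using openin_topspace [of "simplex_topology n"] by (simp only: topspace_standard_simplex)
    next
      case 2
      then show ?thesis
        by (simp only: openin_empty)
    qed
  qed
  then show ?thesis
    using X path_components_of_subset [OF C] unfolding Delta_generated_space_def by blast
qed

text \<open>An open partition consists of clopen sets, and a connected set that meets a clopen set
  lies inside it. So the connected component of a point cannot leave its path component.\<close>

lemma path_components_eq_connected_components_of_openin:
  assumes op: "\<And>C. C \<in> path_components_of X \<Longrightarrow> openin X C"
  shows "path_components_of X = connected_components_of X"
proof -
  have "path_component_of_set X x = connected_component_of_set X x" if "x \<in> topspace X" for x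
  proof
    let ?P = "path_component_of_set X x"
    have P: "?P \<in> path_components_of X"
      using that by (simp add: path_component_in_path_components_of)
    \<comment> \<open>The complement is the union of the other path components.\<close>
    have "openin X (topspace X - ?P)"
      using op unfolding complement_path_components_of_Union [OF P] by blast
    then have "closedin X ?P"
      by (simp add: closedin_def path_component_of_subset_topspace)
    from connectedin_clopen_cases [OF connectedin_connected_component_of this op [OF P], of x]
    have "connected_component_of_set X x \<subseteq> ?P \<or> disjnt (connected_component_of_set X x) ?P" .
    \<comment> \<open>Both sets contain \<open>x\<close>.\<close>
    moreover have "\<not> disjnt (connected_component_of_set X x) ?P"
      unfolding disjnt_iff mem_Collect_eq
      using that connected_component_of_refl [of X x] path_component_of_refl [of X x] by blast
    ultimately show "connected_component_of_set X x \<subseteq> ?P"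
      by blast
  qed (rule path_component_subset_connected_component_of)
  then show ?thesis
    unfolding path_components_of_def connected_components_of_def by simp
qed

theorem proposition2p8:
  fixes X :: "'a topology"
  assumes "Delta_generated_space X"
  shows "X homeomorphic_space sum_topology (subtopology X) (connected_components_of X)
    \<and> connected_components_of X = path_components_of X
    \<and> (connected_space X \<longleftrightarrow> path_connected_space X)"
proof -
  have op: "openin X C" if "C \<in> path_components_of X" for C
    using assms that by (rule Delta_generated_space_openin_path_component)
  then have eq: "path_components_of X = connected_components_of X"
    by (rule path_components_eq_connected_components_of_openin)
  have "X homeomorphic_space sum_topology (subtopology X) (connected_components_of X)"
    using homeomorphic_space_sum_topology_partition
      [OF pairwise_disjoint_path_components_of Union_path_components_of op]
    by (simp add: eq)
  \<comment> \<open>Each property says that the respective family has at most one member, and the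
    two families coincide. The empty space, with no components, is included.\<close>
  moreover have "connected_space X \<longleftrightarrow> path_connected_space X"
    unfolding connected_space_iff_components_subset_singleton
      path_connected_space_iff_components_subset_singleton eq ..
  ultimately show ?thesis
    using eq by simp
qed

end
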